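(* Let $s\in\mathbb{N}$, let $R$ be an infinite large Integral Domain, let $A\subseteq R$ be an $IP^{\star}$-set in $(R,+)$, and let $B\subseteq R$ be an $IP_{s}^{\star}$-set in $(R,+)$. Then there exists an $IP^{\star}$-set $D\subseteq R$ in $(R,+)$ such that $\langle r\rangle\setminus\{0\}\subseteq AB$ for all $r\in D$.
   Context: An integral domain $R$ is called a large Integral Domain if every nonzero ideal of $R$ has finite index in $R$ (as an additive subgroup). $\mathbb{N}=\{1,2,3,\dots\}$. For $(S,+)$ a commutative semigroup: $A\subseteq S$ is an $IP$-set if there is a sequence $(x_n)_{n=1}^{\infty}$ in $S$ with $\{\sum_{n\in F}x_n : F\subseteq\mathbb{N}\text{ finite, nonempty}\}\subseteq A$; for $s\in\mathbb{N}$, $A$ is an $IP_s$-set if there is a finite sequence $(x_n)_{n=1}^{s}$ in $S$ with $\{\sum_{n\in F}x_n:\emptyset\neq F\subseteq\{1,\dots,s\}\}\subseteq A$. A subset of $S$ is an $IP^{\star}$-set (respectively $IP_s^{\star}$-set) if it intersects every $IP$-set (respectively every $IP_s$-set) in $S$. For $r\in R$, $\langle r\rangle=rR$ is the principal ideal generated by $r$, and $AB=\{ab:a\in A,\ b\in B\}$. *)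

theory Defs
  imports "HOL-Algebra.Algebra"
begin

text \<open>Index in the sense of the additive group: the number of additive cosets of the ideal.\<close>

definition large_domain :: "('a, 'm) ring_scheme \<Rightarrow> bool" where
  "large_domain R \<longleftrightarrow>
     domain R \<and> (\<forall>I. ideal I R \<and> I \<noteq> {\<zero>\<^bsub>R\<^esub>} \<longrightarrow> finite (a_rcosets\<^bsub>R\<^esub> I))"

text \<open>The notions below refer to the additive structure of \<open>R\<close> only. Sequences are indexed from 1,
  and their values at index 0 are unconstrained.\<close>

definition IP_set :: "('a, 'm) ring_scheme \<Rightarrow> 'a set \<Rightarrow> bool" where
  "IP_set R A \<longleftrightarrow> A \<subseteq> carrier R \<and>
     (\<exists>x \<in> {1::nat..} \<rightarrow> carrier R.
        {finsum R x F | F. F \<subseteq> {1..} \<and> finite F \<and> F \<noteq> {}} \<subseteq> A)"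

definition IP_fin_set :: "nat \<Rightarrow> ('a, 'm) ring_scheme \<Rightarrow> 'a set \<Rightarrow> bool" where
  "IP_fin_set s R A \<longleftrightarrow> A \<subseteq> carrier R \<and>
     (\<exists>x \<in> {1..s} \<rightarrow> carrier R.
        {finsum R x F | F. F \<subseteq> {1..s} \<and> F \<noteq> {}} \<subseteq> A)"

definition IP_star :: "('a, 'm) ring_scheme \<Rightarrow> 'a set \<Rightarrow> bool" where
  "IP_star R A \<longleftrightarrow> A \<subseteq> carrier R \<and> (\<forall>C. IP_set R C \<longrightarrow> A \<inter> C \<noteq> {})"

definition IP_fin_star :: "nat \<Rightarrow> ('a, 'm) ring_scheme \<Rightarrow> 'a set \<Rightarrow> bool" where
  "IP_fin_star s R A \<longleftrightarrow> A \<subseteq> carrier R \<and> (\<forall>C. IP_fin_set s R C \<longrightarrow> A \<inter> C \<noteq> {})"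

end

theory Submission
  imports Defs
begin

text \<open>Choose \<open>y\<^sub>1, \<dots>, y\<^sub>s\<close> all of whose nonempty subset sums \<open>y\<^sub>F\<close> are nonzero and let \<open>D\<close> be
  the intersection of the finitely many dilates \<open>y\<^sub>F A\<close>. For every \<open>m\<close> the elements \<open>m y\<^sub>F\<close> form an
  \<open>IP\<^sub>s\<close>-set, so some \<open>m y\<^sub>F\<close> lies in \<open>B\<close>, and \<open>m r = (r / y\<^sub>F) (m y\<^sub>F)\<close> lies in \<open>A B\<close> for \<open>r \<in> D\<close>.
  Each dilate is \<open>IP\<^sup>\<star>\<close> because \<open>\<langle>y\<^sub>F\<rangle>\<close> has finite index, and \<open>IP\<^sup>\<star>\<close>-sets are closed under finite
  intersections by Hindman's theorem, for which we use Baumgartner's argument.\<close>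

section \<open>Hindman's theorem\<close>

text \<open>Rich families replace the families of finite unions of infinite block sequences: every such
  family is rich, but no generating sequence has to be exhibited.\<close>

definition rich :: "nat set set \<Rightarrow> bool" where
  "rich U \<longleftrightarrow> (\<forall>Z\<in>U. finite Z \<and> Z \<noteq> {}) \<and>
     (\<forall>Z\<in>U. \<forall>Y\<in>U. (\<forall>x\<in>Z. \<forall>y\<in>Y. x < y) \<longrightarrow> Z \<union> Y \<in> U) \<and>
     (\<forall>n. \<exists>Z\<in>U. Z \<subseteq> {n..})"

definition large :: "nat set set \<Rightarrow> nat set set \<Rightarrow> bool" where
  "large U C \<longleftrightarrow> (\<forall>V. rich V \<and> V \<subseteq> U \<longrightarrow> V \<inter> C \<noteq> {})"

section \<open>Rich families and partitions of large sets\<close>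

lemma rich_finite: "rich U \<Longrightarrow> Z \<in> U \<Longrightarrow> finite Z"
  and rich_nonempty: "rich U \<Longrightarrow> Z \<in> U \<Longrightarrow> Z \<noteq> {}"
  and rich_union: "rich U \<Longrightarrow> Z \<in> U \<Longrightarrow> Y \<in> U \<Longrightarrow> (\<And>x y. x \<in> Z \<Longrightarrow> y \<in> Y \<Longrightarrow> x < y) \<Longrightarrow> Z \<union> Y \<in> U"
  and rich_unbounded: "rich U \<Longrightarrow> \<exists>Z\<in>U. Z \<subseteq> {n..}"
  unfolding rich_def by blast+

lemma rich_tail:
  assumes "rich U"
  shows "rich {Z \<in> U. Z \<subseteq> {n..}}"
  unfolding rich_def
proof (intro conjI allI)
  fix k
  obtain Z where "Z \<in> U" "Z \<subseteq> {max n k..}"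
    using rich_unbounded[OF assms] by blast
  then show "\<exists>Z\<in>{Z \<in> U. Z \<subseteq> {n..}}. Z \<subseteq> {k..}"
    by fastforce
qed (use rich_finite[OF assms] rich_nonempty[OF assms] rich_union[OF assms] in auto)

lemma large_mono: "large U C \<Longrightarrow> V \<subseteq> U \<Longrightarrow> large V C"
  unfolding large_def by blast

text \<open>If \<open>C1\<close> is not large for \<open>U\<close>, some rich \<open>V\<close>
  inside \<open>U\<close> avoids it. Every rich subfamily of \<open>V\<close> still meets
  \<open>C\<close>, and away from \<open>C1\<close> it can only do so in \<open>C2\<close>.\<close>

lemma large_Un:
  assumes "rich U" "large U C" "C \<inter> U \<subseteq> C1 \<union> C2"
  obtains V where "rich V" "V \<subseteq> U" "large V C1 \<or> large V C2"
proof (cases "large U C1")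
  case True
  then show ?thesis using assms that by blast
next
  case False
  then obtain V where V: "rich V" "V \<subseteq> U" "V \<inter> C1 = {}"
    unfolding large_def by blast
  have "large V C2"
    unfolding large_def
  proof (intro allI impI)
    fix W assume W: "rich W \<and> W \<subseteq> V"
    then have "W \<inter> C \<noteq> {}" using assms(2) V unfolding large_def by blast
    then show "W \<inter> C2 \<noteq> {}" using assms(3) V W by blast
  qed
  then show ?thesis using V that by blast
qed

lemma large_UN:
  assumes "finite E" "rich U" "large U C" "C \<inter> U \<subseteq> (\<Union>d\<in>E. P d)"
  shows "\<exists>d\<in>E. \<exists>V. rich V \<and> V \<subseteq> U \<and> large V (P d)"
  using assms
proof (induction E arbitrary: U C rule: finite_induct)
  case empty
  then show ?case unfolding large_def by blast
next
  case (insert d E)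
  have "C \<inter> U \<subseteq> P d \<union> (\<Union>d\<in>E. P d)" using insert.prems by auto
  then obtain V where V: "rich V" "V \<subseteq> U" "large V (P d) \<or> large V (\<Union>d\<in>E. P d)"
    using large_Un insert.prems by metis
  then show ?case
    using insert.IH[OF V(1), of "\<Union>d\<in>E. P d"] by (meson inf_le1 insertCI subset_trans)
qed

section \<open>Shifting a large set by a finite set\<close>

text \<open>Otherwise every \<open>n\<close> has a counterexample \<open>f n\<close> beyond it.
  Attaching to each \<open>f n\<close> all prefixes from \<open>U\<close> below \<open>n\<close>
  gives a rich subfamily of \<open>U\<close> that misses \<open>C\<close>.\<close>

lemma large_shift_cover:
  assumes U: "rich U" and C: "large U C"
  shows "\<exists>n. \<forall>Z\<in>U. Z \<subseteq> {n..} \<longrightarrow> (\<exists>d\<in>U. d \<subseteq> {..<n} \<and> d \<union> Z \<in> C)"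
proof (rule ccontr)
  assume "\<not> ?thesis"
  then obtain f where f: "\<And>n. f n \<in> U" "\<And>n. f n \<subseteq> {n..}"
    and fC: "\<And>n d. d \<in> U \<Longrightarrow> d \<subseteq> {..<n} \<Longrightarrow> d \<union> f n \<notin> C"
    by metis
  define V where "V = {d \<union> f n | d n. d \<in> U \<and> d \<subseteq> {..<n}}"
  have VU: "d \<union> f n \<in> U" if "d \<in> U" "d \<subseteq> {..<n}" for d n
    using rich_union[OF U that(1) f(1)] that f(2) by (meson atLeast_iff lessThan_iff less_le_trans subsetD)
  have "rich V"
    unfolding rich_def
  proof (intro conjI allI ballI impI)
    fix Z Y assume "Z \<in> V" "Y \<in> V" and less: "\<forall>x\<in>Z. \<forall>y\<in>Y. x < y"
    then obtain d n d' m where Z: "Z = d \<union> f n" "d \<in> U" "d \<subseteq> {..<n}"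
      and Y: "Y = d' \<union> f m" "d' \<in> U" "d' \<subseteq> {..<m}"
      unfolding V_def by blast
    have ZU: "Z \<in> U" using Z VU by blast
    \<comment> \<open>The whole of \<open>Z\<close> is absorbed into the prefix of
      \<open>f m\<close>. It lies below \<open>m\<close> because it lies below some element of the
      nonempty set \<open>d'\<close>.\<close>
    have "Z \<union> d' \<in> U" by (rule rich_union[OF U ZU Y(2)]) (use less Y in auto)
    moreover have "Z \<union> d' \<subseteq> {..<m}"
    proof -
      obtain y where "y \<in> d'" using rich_nonempty[OF U Y(2)] by blast
      then have "y < m" "\<forall>z\<in>Z. z < y" using less Y by auto
      then show ?thesis using Y(3) less_trans by blast
    qed
    moreover have "Z \<union> Y = Z \<union> d' \<union> f m" using Y(1) by blast
    ultimately show "Z \<union> Y \<in> V" unfolding V_def by blast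
  next
    fix n
    obtain d where d: "d \<in> U" "d \<subseteq> {n..}" using rich_unbounded[OF U] by blast
    define m where "m = Suc (Max d)"
    have "d \<subseteq> {..<m}" using Max_ge[OF rich_finite[OF U d(1)]] by (auto simp: m_def less_Suc_eq_le)
    moreover from this have "n \<le> m" using d(2) rich_nonempty[OF U d(1)] by fastforce
    ultimately have "d \<union> f m \<in> V" "d \<union> f m \<subseteq> {n..}"
      using d f(2)[of m] by (auto simp: V_def)
    then show "\<exists>Z\<in>V. Z \<subseteq> {n..}" by blast
  qed (use VU rich_finite[OF U] rich_nonempty[OF U] in \<open>auto simp: V_def\<close>)
  moreover have "V \<subseteq> U" using VU by (auto simp: V_def)
  moreover have "V \<inter> C = {}" using fC by (auto simp: V_def)
  ultimately show False using C unfolding large_def by blast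
qed

text \<open>The bound \<open>n\<close> of the cover leaves only finitely many prefixes
  \<open>d\<close>. Their shift sets cover \<open>C\<close> on the tail of \<open>U\<close> from
  \<open>n\<close> on, so one of them is large for a rich subfamily of that tail.\<close>

lemma large_shift:
  assumes U: "rich U" and C: "large U C"
  obtains d V where "d \<in> U" "rich V" "V \<subseteq> U" "\<forall>Z\<in>V. \<forall>x\<in>d. \<forall>y\<in>Z. x < y"
    "large V {Z \<in> C. d \<union> Z \<in> C}"
proof -
  obtain n where n: "\<And>Z. Z \<in> U \<Longrightarrow> Z \<subseteq> {n..} \<Longrightarrow> \<exists>d\<in>U. d \<subseteq> {..<n} \<and> d \<union> Z \<in> C"
    using large_shift_cover[OF assms] by blast
  let ?W = "{Z \<in> U. Z \<subseteq> {n..}}" and ?E = "{d \<in> U. d \<subseteq> {..<n}}"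
  have "finite ?E" by (rule finite_subset[of _ "Pow {..<n}"]) auto
  moreover have "large ?W C" by (rule large_mono[OF C]) blast
  moreover have "C \<inter> ?W \<subseteq> (\<Union>d\<in>?E. {Z \<in> C. d \<union> Z \<in> C})" using n by blast
  ultimately have "\<exists>d\<in>?E. \<exists>V. rich V \<and> V \<subseteq> ?W \<and> large V {Z \<in> C. d \<union> Z \<in> C}"
    by (rule large_UN[OF _ rich_tail[OF U]])
  then obtain d V where d: "d \<in> U" "d \<subseteq> {..<n}" and V: "rich V" "V \<subseteq> ?W"
    and dV: "large V {Z \<in> C. d \<union> Z \<in> C}"
    by blast
  have "x < y" if "Z \<in> V" "x \<in> d" "y \<in> Z" for Z x y
  proof -
    have "x < n" "n \<le> y" using d(2) V(2) that by auto
    then show ?thesis by simp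
  qed
  then show thesis using that[of d V] d(1) V dV by blast
qed

section \<open>Block sequences inside large sets\<close>

text \<open>Iterating \<open>large_shift\<close> gives sets \<open>d n\<close> and shrinking large
  sets \<open>P n\<close>, where membership in \<open>P n\<close> means that adjoining any of
  \<open>d 0\<close>, ..., \<open>d (n - 1)\<close> stays in \<open>C\<close>. Each
  \<open>P n\<close> contains a finite union of sets \<open>d i\<close> with
  \<open>i \<ge> n\<close>; such unions, taken far enough apart, are the blocks.\<close>

lemma large_imp_block_sequence:
  assumes "rich U" "large U C"
  obtains e :: "nat \<Rightarrow> nat set" where "\<forall>k. finite (e k)" "disjoint_family e"
    "\<forall>K. finite K \<and> K \<noteq> {} \<longrightarrow> \<Union>(e ` K) \<in> C"
proof -
  \<comment> \<open>A state pairs a family with a set large for it; \<open>Q p q d\<close> records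
    one application of \<open>large_shift\<close>, with \<open>d\<close> as the prefix split
    off.\<close>
  define Q where "Q p q d \<longleftrightarrow> d \<in> fst p \<and> fst q \<subseteq> fst p \<and>
      (\<forall>Z\<in>fst q. \<forall>x\<in>d. \<forall>y\<in>Z. x < y) \<and> snd q = {Z \<in> snd p. d \<union> Z \<in> snd p}"
    for p q :: "nat set set \<times> nat set set" and d
  have "\<exists>f. \<forall>n. ((n = 0 \<longrightarrow> f n = (U, C)) \<and> rich (fst (f n)) \<and> large (fst (f n)) (snd (f n)))
      \<and> (\<exists>d. Q (f n) (f (Suc n)) d)"
  proof (rule dependent_nat_choice)
    fix p n assume "(n = (0::nat) \<longrightarrow> p = (U, C)) \<and> rich (fst p) \<and> large (fst p) (snd p)"
    then have p: "rich (fst p)" "large (fst p) (snd p)" by simp_all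
    obtain d V where d: "d \<in> fst p" and V: "rich V" "V \<subseteq> fst p"
        "\<forall>Z\<in>V. \<forall>x\<in>d. \<forall>y\<in>Z. x < y" "large V {Z \<in> snd p. d \<union> Z \<in> snd p}"
      by (rule large_shift[OF p])
    let ?q = "(V, {Z \<in> snd p. d \<union> Z \<in> snd p})"
    have "Q p ?q d" using d V(2,3) by (simp add: Q_def)
    with V(1,4) show "\<exists>q. ((Suc n = 0 \<longrightarrow> q = (U, C)) \<and> rich (fst q) \<and> large (fst q) (snd q)) \<and> (\<exists>d. Q p q d)"
      by (intro exI[of _ ?q]) auto
  qed (use assms in auto)
  then obtain f where f0: "f 0 = (U, C)"
    and f: "\<And>n. rich (fst (f n))" "\<And>n. large (fst (f n)) (snd (f n))" "\<And>n. \<exists>d. Q (f n) (f (Suc n)) d"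
    by blast
  from f(3) obtain d where fd: "\<And>n. Q (f n) (f (Suc n)) (d n)" by metis
  define V where "V n = fst (f n)" for n
  define P where "P n = snd (f n)" for n
  have V: "rich (V n)" and P: "large (V n) (P n)" and dV: "d n \<in> V n" and V_Suc: "V (Suc n) \<subseteq> V n"
    and d_less: "\<And>Z x y. Z \<in> V (Suc n) \<Longrightarrow> x \<in> d n \<Longrightarrow> y \<in> Z \<Longrightarrow> x < y"
    and P_Suc: "P (Suc n) = {Z \<in> P n. d n \<union> Z \<in> P n}" for n
    using f(1,2)[of n] fd[of n] unfolding V_def P_def Q_def by blast+
  have P0: "P 0 = C" by (simp add: P_def f0)
  have V_anti: "V m \<subseteq> V n" if "n \<le> m" for n m
    using lift_Suc_antimono_le[of V, OF V_Suc that] .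
  have d_mono: "x < y" if "i < j" "x \<in> d i" "y \<in> d j" for i j x y
    using d_less[of "d j" i x y] V_anti[of "Suc i" j] dV[of j] that by auto
  have V_tail: "Z \<subseteq> {n..}" if "Z \<in> V n" for Z n
    using that
  \<comment> \<open>Members of \<open>V (Suc n)\<close> lie strictly above the nonempty set
    \<open>d n\<close>, so each step raises the lower bound by at least one.\<close>
  proof (induction n arbitrary: Z)
    case (Suc n)
    obtain x where "x \<in> d n" using rich_nonempty[OF V dV] by blast
    then show ?case using d_less[OF Suc.prems] Suc.IH[OF dV] by fastforce
  qed simp
  have UN_d: "\<Union>(d ` F) \<in> V n" if "finite F" "F \<noteq> {}" "F \<subseteq> {n..}" for F n
    using that
  proof (induction F rule: finite_linorder_max_induct)
    case (insert b F)
    have b: "d b \<in> V n" using V_anti[of n b] dV[of b] insert.prems by auto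
    show ?case
    proof (cases "F = {}")
      case False
      then have "\<Union>(d ` F) \<in> V n" using insert by auto
      then have "\<Union>(d ` F) \<union> d b \<in> V n"
        by (rule rich_union[OF V _ b]) (use d_mono insert.hyps in blast)
      then show ?thesis by (simp add: Un_commute)
    qed (use b in simp)
  qed simp
  \<comment> \<open>The unions of the \<open>d i\<close> with \<open>i \<ge> n\<close> form a rich
    subfamily of \<open>V n\<close>, so the set \<open>P n\<close>, being large for
    \<open>V n\<close>, contains one of them.\<close>
  have "\<exists>F. finite F \<and> F \<noteq> {} \<and> F \<subseteq> {n..} \<and> \<Union>(d ` F) \<in> P n" for n
  proof -
    let ?W = "{\<Union>(d ` F) | F. finite F \<and> F \<noteq> {} \<and> F \<subseteq> {n..}}"
    have W: "?W \<subseteq> V n" using UN_d by blast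
    have "rich ?W"
      unfolding rich_def
    proof (intro conjI ballI allI impI)
      fix Z Y assume "Z \<in> ?W" "Y \<in> ?W"
      then obtain F G where "finite F" "F \<noteq> {}" "F \<subseteq> {n..}" "finite G" "G \<noteq> {}" "G \<subseteq> {n..}"
        "Z = \<Union>(d ` F)" "Y = \<Union>(d ` G)" by blast
      then show "Z \<union> Y \<in> ?W" by (intro CollectI exI[of _ "F \<union> G"]) auto
    next
      fix k
      have "d (max n k) \<in> ?W" by (intro CollectI exI[of _ "{max n k}"]) auto
      moreover have "d (max n k) \<subseteq> {k..}" using V_tail[OF dV] by fastforce
      ultimately show "\<exists>Z\<in>?W. Z \<subseteq> {k..}" by blast
    next
      fix Z assume "Z \<in> ?W"
      then have "Z \<in> V n" using W by (rule rev_subsetD)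
      then show "finite Z" "Z \<noteq> {}" by (rule rich_finite[OF V], rule rich_nonempty[OF V])
    qed
    then have "?W \<inter> P n \<noteq> {}" using P[of n] W unfolding large_def by simp
    then show ?thesis by blast
  qed
  then obtain F where F: "\<And>n. finite (F n)" "\<And>n. F n \<noteq> {}" "\<And>n. F n \<subseteq> {n..}" "\<And>n. \<Union>(d ` F n) \<in> P n"
    by metis
  \<comment> \<open>By \<open>P_Suc\<close>, a member \<open>Z\<close> of \<open>P (Suc m)\<close>
    yields both \<open>Z\<close> and \<open>d m \<union> Z\<close> in \<open>P m\<close>. The
    induction uses one or the other according to whether \<open>m\<close> is in
    \<open>G\<close>.\<close>
  have absorb: "\<Union>(d ` G) \<union> Z \<in> C" if "Z \<in> P m" "G \<subseteq> {..<m}" for Z G m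
    using that
  proof (induction m arbitrary: Z G)
    case 0
    then show ?case by (simp add: P0)
  next
    case (Suc m)
    then have Z: "Z \<in> P m" "d m \<union> Z \<in> P m" by (auto simp: P_Suc)
    show ?case
    proof (cases "m \<in> G")
      case True
      have "G - {m} \<subseteq> {..<m}" using Suc.prems by auto
      from Suc.IH[OF Z(2) this] have "\<Union>(d ` (G - {m})) \<union> (d m \<union> Z) \<in> C" .
      also have "\<Union>(d ` (G - {m})) \<union> (d m \<union> Z) = \<Union>(d ` G) \<union> Z" using True by blast
      finally show ?thesis .
    next
      case False
      then have "G \<subseteq> {..<m}" using Suc.prems less_Suc_eq by fastforce
      then show ?thesis using Suc.IH Z by blast
    qed
  qed
  \<comment> \<open>The starting points are spaced so that the index set \<open>F (N k)\<close> lies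
    in the interval from \<open>N k\<close> up to, but excluding, \<open>N (Suc k)\<close>.\<close>
  define N where "N k = ((\<lambda>n. Suc (Max (F n))) ^^ k) 0" for k
  have N_Suc: "N (Suc k) = Suc (Max (F (N k)))" for k by (simp add: N_def)
  have F_less: "F (N k) \<subseteq> {..<N (Suc k)}" for k
    using Max_ge[OF F(1)] by (auto simp: N_Suc less_Suc_eq_le)
  have "N k \<le> N (Suc k)" for k
    using F(2)[of "N k"] F(3)[of "N k"] F_less[of k] by fastforce
  then have N_mono: "N i \<le> N j" if "i \<le> j" for i j
    using lift_Suc_mono_le[of N] that by blast
  have F_block: "F (N i) \<subseteq> {..<N j}" if "i < j" for i j
    using F_less[of i] N_mono[of "Suc i" j] that by fastforce
  define e where "e k = \<Union>(d ` F (N k))" for k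
  show thesis
  proof (rule that[of e])
    show "\<forall>k. finite (e k)" using F(1) rich_finite[OF V dV] by (auto simp: e_def)
    have "e i \<inter> e j = {}" if "i < j" for i j
    proof -
      have "x < y" if x: "x \<in> e i" and y: "y \<in> e j" for x y
      proof -
        obtain a b where "a \<in> F (N i)" "x \<in> d a" "b \<in> F (N j)" "y \<in> d b"
          using x y by (auto simp: e_def)
        moreover from this have "a < b" using F_block[OF \<open>i < j\<close>] F(3)[of "N j"] by fastforce
        ultimately show ?thesis using d_mono by blast
      qed
      then show ?thesis by blast
    qed
    then show "disjoint_family e" unfolding disjoint_family_on_def by (metis inf_commute nat_neq_iff)
    have "\<Union>(e ` K) \<in> C" if K: "finite K" "K \<noteq> {}" for K
    proof -
    \<comment> \<open>The last block lies in \<open>P (N k)\<close>, and all earlier blocks are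
      unions of sets \<open>d i\<close> with \<open>i < N k\<close>, so \<open>absorb\<close>
      adjoins them all at once.\<close>
    define k where "k = Max K"
    have "\<Union>(F ` N ` (K - {k})) \<subseteq> {..<N k}"
    proof -
      have "j < k" if "j \<in> K - {k}" for j using Max_ge[OF K(1), of j] that by (auto simp: k_def)
      then show ?thesis using F_block by blast
    qed
    moreover have "e k \<in> P (N k)" by (simp add: e_def F)
    ultimately have "\<Union>(d ` \<Union>(F ` N ` (K - {k}))) \<union> e k \<in> C" using absorb by blast
    also have "\<Union>(d ` \<Union>(F ` N ` (K - {k}))) \<union> e k = \<Union>(e ` K)"
      using Max_in[OF K] by (auto simp: e_def k_def)
    finally show ?thesis .
    qed
    then show "\<forall>K. finite K \<and> K \<noteq> {} \<longrightarrow> \<Union>(e ` K) \<in> C" by blast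
  qed
qed

section \<open>The finite unions theorem\<close>

text \<open>The family of all nonempty finite sets is rich and large for itself, so one colour class
  is large for a rich subfamily. Both classes are cut down to \<open>?U\<close>, which makes the
  resulting unions nonempty.\<close>

theorem hindman_finite_unions:
  fixes \<C> :: "nat set set"
  obtains e :: "nat \<Rightarrow> nat set" where "\<forall>k. finite (e k)" "disjoint_family e"
    "(\<forall>K. finite K \<and> K \<noteq> {} \<longrightarrow> \<Union>(e ` K) \<in> \<C> \<and> \<Union>(e ` K) \<noteq> {}) \<or>
     (\<forall>K. finite K \<and> K \<noteq> {} \<longrightarrow> \<Union>(e ` K) \<notin> \<C> \<and> \<Union>(e ` K) \<noteq> {})"
proof -
  let ?U = "{Z :: nat set. finite Z \<and> Z \<noteq> {}}"
  have "rich ?U"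
    unfolding rich_def
  proof (intro conjI allI)
    fix n :: nat
    show "\<exists>Z\<in>?U. Z \<subseteq> {n..}" by (intro bexI[of _ "{n}"]) auto
  qed auto
  moreover have "large ?U ?U"
    unfolding large_def
  proof (intro allI impI)
    fix V assume V: "rich V \<and> V \<subseteq> ?U"
    then obtain Z where "Z \<in> V" using rich_unbounded[of V] by blast
    then show "V \<inter> ?U \<noteq> {}" using V by blast
  qed
  moreover have "?U \<inter> ?U \<subseteq> (\<C> \<inter> ?U) \<union> (?U - \<C>)" by blast
  ultimately obtain V where V: "rich V" "large V (\<C> \<inter> ?U) \<or> large V (?U - \<C>)"
    by (rule large_Un)
  from V(2) show thesis
  proof
    assume "large V (\<C> \<inter> ?U)"
    then obtain e :: "nat \<Rightarrow> nat set" where "\<forall>k. finite (e k)" "disjoint_family e"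
      "\<forall>K. finite K \<and> K \<noteq> {} \<longrightarrow> \<Union>(e ` K) \<in> \<C> \<inter> ?U"
      by (rule large_imp_block_sequence[OF V(1)])
    then show thesis by (intro that) auto
  next
    assume "large V (?U - \<C>)"
    then obtain e :: "nat \<Rightarrow> nat set" where "\<forall>k. finite (e k)" "disjoint_family e"
      "\<forall>K. finite K \<and> K \<noteq> {} \<longrightarrow> \<Union>(e ` K) \<in> ?U - \<C>"
      by (rule large_imp_block_sequence[OF V(1)])
    then show thesis by (intro that) auto
  qed
qed

section \<open>IP sets in the additive group of a ring\<close>

definition FS :: "('a, 'm) ring_scheme \<Rightarrow> (nat \<Rightarrow> 'a) \<Rightarrow> 'a set" where
  "FS R x = {finsum R x F | F. F \<subseteq> {1..} \<and> finite F \<and> F \<noteq> {}}"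

lemma FS_I: "F \<subseteq> {1..} \<Longrightarrow> finite F \<Longrightarrow> F \<noteq> {} \<Longrightarrow> finsum R x F \<in> FS R x"
  unfolding FS_def by blast

lemma IP_set_alt:
  "IP_set R A \<longleftrightarrow> A \<subseteq> carrier R \<and> (\<exists>x \<in> {1::nat..} \<rightarrow> carrier R. FS R x \<subseteq> A)"
  unfolding IP_set_def FS_def ..

lemma IP_star_subset: "IP_star R A \<Longrightarrow> A \<subseteq> carrier R"
  and IP_star_meets: "IP_star R A \<Longrightarrow> IP_set R C \<Longrightarrow> A \<inter> C \<noteq> {}"
  unfolding IP_star_def by blast+

context ring
begin

lemma FS_closed: "x \<in> {1::nat..} \<rightarrow> carrier R \<Longrightarrow> FS R x \<subseteq> carrier R"
  unfolding FS_def by (auto intro!: finsum_closed)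

lemma IP_set_FS: "x \<in> {1::nat..} \<rightarrow> carrier R \<Longrightarrow> IP_set R (FS R x)"
  unfolding IP_set_alt using FS_closed by blast

text \<open>Finite index sets are coloured by whether their sum lies in \<open>A\<close>. Sums over
  the disjoint blocks \<open>e k\<close> form the new sequence, and its finite sums are sums over
  unions of blocks, hence all of one colour.\<close>

lemma hindman:
  assumes "IP_set R C"
  shows "IP_set R (C \<inter> A) \<or> IP_set R (C - A)"
proof -
  obtain x where x: "x \<in> {1::nat..} \<rightarrow> carrier R" "FS R x \<subseteq> C" and C: "C \<subseteq> carrier R"
    using assms unfolding IP_set_alt by blast
  \<comment> \<open>The shift to indices from 0 matches \<open>hindman_finite_unions\<close>, which
    colours all finite sets of naturals.\<close>
  define x' where "x' n = x (Suc n)" for n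
  have x'c: "x' n \<in> carrier R" for n using x(1) by (auto simp: x'_def)
  have x'C: "finsum R x' F \<in> C" if "finite F" "F \<noteq> {}" for F
  proof -
    have "finsum R x' F = finsum R x (Suc ` F)"
      unfolding x'_def using x(1) by (subst finsum_reindex) auto
    also have "\<dots> \<in> FS R x" using that by (intro FS_I) auto
    finally show ?thesis using x(2) by blast
  qed
  obtain e :: "nat \<Rightarrow> nat set" where e: "\<forall>k. finite (e k)" "disjoint_family e"
    "(\<forall>K. finite K \<and> K \<noteq> {} \<longrightarrow> \<Union>(e ` K) \<in> {F. finsum R x' F \<in> A} \<and> \<Union>(e ` K) \<noteq> {}) \<or>
     (\<forall>K. finite K \<and> K \<noteq> {} \<longrightarrow> \<Union>(e ` K) \<notin> {F. finsum R x' F \<in> A} \<and> \<Union>(e ` K) \<noteq> {})"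
    by (rule hindman_finite_unions[of "{F. finsum R x' F \<in> A}"])
  define y where "y k = finsum R x' (e k)" for k
  have y: "y \<in> {1..} \<rightarrow> carrier R" using x'c by (auto simp: y_def)
  have y_sum: "finsum R y K = finsum R x' (\<Union>(e ` K))" if "finite K" for K
    unfolding y_def
    by (rule add.finprod_UN_disjoint[symmetric])
      (use that e(1,2) x'c in \<open>auto simp: disjoint_family_on_def pairwise_def disjnt_def\<close>)
  from e(3) show ?thesis
  proof
    assume *: "\<forall>K. finite K \<and> K \<noteq> {} \<longrightarrow> \<Union>(e ` K) \<in> {F. finsum R x' F \<in> A} \<and> \<Union>(e ` K) \<noteq> {}"
    have "FS R y \<subseteq> C \<inter> A"
    proof
      fix a assume "a \<in> FS R y"
      then obtain K where "finite K" "K \<noteq> {}" "a = finsum R y K" unfolding FS_def by blast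
      then show "a \<in> C \<inter> A" using * x'C[of "\<Union>(e ` K)"] y_sum e(1) by auto
    qed
    then show ?thesis using y C unfolding IP_set_alt by blast
  next
    assume *: "\<forall>K. finite K \<and> K \<noteq> {} \<longrightarrow> \<Union>(e ` K) \<notin> {F. finsum R x' F \<in> A} \<and> \<Union>(e ` K) \<noteq> {}"
    have "FS R y \<subseteq> C - A"
    proof
      fix a assume "a \<in> FS R y"
      then obtain K where "finite K" "K \<noteq> {}" "a = finsum R y K" unfolding FS_def by blast
      then show "a \<in> C - A" using * x'C[of "\<Union>(e ` K)"] y_sum e(1) by auto
    qed
    then show ?thesis using y C unfolding IP_set_alt by blast
  qed
qed

section \<open>Finite intersections of IP-star sets\<close>

text \<open>An IP set \<open>C - A\<close> would have to meet \<open>A\<close>, so Hindman's theorem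
  leaves only the other part of \<open>C\<close>.\<close>

lemma IP_star_Int_IP_set:
  assumes "IP_star R A" "IP_set R C"
  shows "IP_set R (C \<inter> A)"
proof -
  have "A \<inter> (C - A) = {}" by blast
  then have "\<not> IP_set R (C - A)" using IP_star_meets[OF assms(1)] by metis
  then show ?thesis using hindman[OF assms(2)] by metis
qed

lemma IP_star_Int:
  assumes "IP_star R A" "IP_star R B"
  shows "IP_star R (A \<inter> B)"
  unfolding IP_star_def
proof (intro conjI allI impI)
  fix C assume "IP_set R C"
  then have "B \<inter> (C \<inter> A) \<noteq> {}" using IP_star_Int_IP_set IP_star_meets assms by blast
  then show "A \<inter> B \<inter> C \<noteq> {}" by blast
qed (use IP_star_subset[OF assms(1)] in blast)

lemma IP_star_carrier: "IP_star R (carrier R)"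
  unfolding IP_star_def
proof (intro conjI allI impI)
  fix C assume "IP_set R C"
  then obtain x where "FS R x \<subseteq> C" "C \<subseteq> carrier R" unfolding IP_set_alt by blast
  moreover have "finsum R x {1} \<in> FS R x" by (rule FS_I) auto
  ultimately show "carrier R \<inter> C \<noteq> {}" by blast
qed simp

text \<open>The factor \<open>carrier R\<close> covers empty \<open>I\<close>, where the bare
  intersection would be the whole type.\<close>

lemma IP_star_INT:
  assumes "finite I" "\<And>i. i \<in> I \<Longrightarrow> IP_star R (A i)"
  shows "IP_star R (carrier R \<inter> (\<Inter>i\<in>I. A i))"
  using assms
proof (induction I rule: finite_induct)
  case empty
  then show ?case by (simp add: IP_star_carrier)
next
  case (insert i I)
  then have "IP_star R (A i \<inter> (carrier R \<inter> (\<Inter>i\<in>I. A i)))"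
    using IP_star_Int[of "A i"] by blast
  then show ?case by (simp add: Int_left_commute)
qed

text \<open>Two of the partial sums \<open>x\<^sub>1 + \<dots> + x\<^sub>n\<close> lie in the same coset, and their difference is again a
  finite sum of the sequence.\<close>

lemma IP_star_finite_index:
  assumes I: "ideal I R" and fin: "finite (a_rcosets I)"
  shows "IP_star R I"
  unfolding IP_star_def
proof (intro conjI allI impI)
  interpret I: ideal I R by fact
  show "I \<subseteq> carrier R" by (rule I.a_subset)
  fix C assume "IP_set R C"
  then obtain x where x: "x \<in> {1::nat..} \<rightarrow> carrier R" "FS R x \<subseteq> C"
    unfolding IP_set_alt by blast
  define S where "S n = finsum R x {1..n}" for n
  have S: "S n \<in> carrier R" for n unfolding S_def using x(1) by (intro finsum_closed) auto
  have "range (\<lambda>n. I +> S n) \<subseteq> a_rcosets I"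
    using S I.a_subset by (auto intro!: a_rcosetsI)
  then have "\<not> inj (\<lambda>n. I +> S n)"
    using fin by (meson finite_imageD finite_subset infinite_UNIV_nat)
  then obtain m n where "m < n" and eq: "I +> S m = I +> S n"
    unfolding inj_def by (metis nat_neq_iff)
  define T where "T = finsum R x {Suc m..n}"
  have T: "T \<in> carrier R" unfolding T_def using x(1) by (intro finsum_closed) auto
  have "{1..n} = {1..m} \<union> {Suc m..n}" using \<open>m < n\<close> by auto
  then have "S n = S m \<oplus> T"
    unfolding S_def T_def using x(1) by (simp only:) (rule finsum_Un_disjoint, auto)
  moreover have "S n \<in> I +> S m" unfolding eq by (rule I.a_rcos_self[OF S])
  ultimately have "S m \<oplus> T \<oplus> \<ominus> S m \<in> I" using I.a_rcos_module_imp[OF S] by simp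
  then have "T \<in> I" using T S[of m] by (simp add: a_ac r_neg)
  moreover have "T \<in> C" using FS_I[of "{Suc m..n}" R x] x(2) \<open>m < n\<close> by (auto simp: T_def)
  ultimately show "I \<inter> C \<noteq> {}" by blast
qed

end

section \<open>Dilates of IP-star sets\<close>

context domain
begin

text \<open>The ideal of \<open>y\<close> is IP-star, so \<open>C\<close> contains an IP set of
  multiples of \<open>y\<close>. Writing its generators as \<open>w n \<otimes> y\<close> gives a
  sequence \<open>w\<close> with a finite sum in \<open>A\<close>; multiplying that sum by
  \<open>y\<close> leads back into \<open>C\<close>.\<close>

lemma IP_star_dilate:
  assumes A: "IP_star R A" and y: "y \<in> carrier R" "y \<noteq> \<zero>" and fin: "finite (a_rcosets (PIdl y))"
  shows "IP_star R ((\<lambda>a. a \<otimes> y) ` A)"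
  unfolding IP_star_def
proof (intro conjI allI impI)
  show "(\<lambda>a. a \<otimes> y) ` A \<subseteq> carrier R" using IP_star_subset[OF A] y by auto
  fix C assume "IP_set R C"
  then have "IP_set R (C \<inter> PIdl y)"
    using IP_star_Int_IP_set IP_star_finite_index[OF cgenideal_ideal[OF y(1)] fin] by blast
  then obtain z where z: "z \<in> {1::nat..} \<rightarrow> carrier R" "FS R z \<subseteq> C \<inter> PIdl y"
    unfolding IP_set_alt by blast
  have "\<exists>w\<in>carrier R. z n = w \<otimes> y" if "n \<ge> 1" for n
  proof -
    \<comment> \<open>Sums over singletons show that the generators themselves lie in the
      ideal.\<close>
    have "finsum R z {n} \<in> FS R z" using that by (intro FS_I) auto
    moreover have "finsum R z {n} = z n"
      using funcset_mem[OF z(1)] that by (subst finsum_insert[of "{}", simplified]) auto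
    ultimately have "z n \<in> PIdl y" using z(2) by auto
    then show ?thesis unfolding cgenideal_def by blast
  qed
  then obtain w where w: "\<And>n. n \<ge> 1 \<Longrightarrow> w n \<in> carrier R \<and> z n = w n \<otimes> y" by metis
  then have wc: "w \<in> {1..} \<rightarrow> carrier R" by auto
  obtain F where F: "F \<subseteq> {1..}" "finite F" "F \<noteq> {}" "finsum R w F \<in> A"
    using IP_star_meets[OF A IP_set_FS[OF wc]] unfolding FS_def by blast
  have "finsum R w F \<otimes> y = finsum R (\<lambda>n. w n \<otimes> y) F"
    using F y wc by (intro finsum_ldistr) auto
  also have "\<dots> = finsum R z F" using F w y z by (intro finsum_cong') auto
  also have "\<dots> \<in> C" using z(2) FS_I[OF F(1-3)] by blast
  finally show "(\<lambda>a. a \<otimes> y) ` A \<inter> C \<noteq> {}" using F(4) by blast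
qed

end

section \<open>Sequences with nonzero subset sums\<close>

text \<open>The next term only has to avoid the negatives of the finitely many earlier subset sums,
  which is possible in an infinite ring.\<close>

lemma (in ring) exists_nonzero_subset_sums:
  assumes "infinite (carrier R)"
  shows "\<exists>y \<in> {1..s::nat} \<rightarrow> carrier R. \<forall>F. F \<subseteq> {1..s} \<and> F \<noteq> {} \<longrightarrow> finsum R y F \<noteq> \<zero>"
proof (induction s)
  case 0
  then show ?case by auto
next
  case (Suc s)
  then obtain y where y: "y \<in> {1..s} \<rightarrow> carrier R"
    and nz: "\<forall>F. F \<subseteq> {1..s} \<and> F \<noteq> {} \<longrightarrow> finsum R y F \<noteq> \<zero>" by (rule bexE)
  \<comment> \<open>\<open>Pow\<close> includes the empty set, so the new term is also nonzero
    itself.\<close>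
  have "finite ((\<lambda>F. \<ominus> finsum R y F) ` Pow {1..s})" by simp
  then obtain a where a: "a \<in> carrier R" "a \<notin> (\<lambda>F. \<ominus> finsum R y F) ` Pow {1..s}"
    using assms by (meson finite_subset subsetI)
  let ?z = "y(Suc s := a)"
  have z: "?z \<in> {1..Suc s} \<rightarrow> carrier R" using y a by (auto simp: le_Suc_eq)
  have old: "finsum R ?z F = finsum R y F" if "F \<subseteq> {1..s}" for F
    using that y by (intro finsum_cong') auto
  have "finsum R ?z F \<noteq> \<zero>" if F: "F \<subseteq> {1..Suc s}" "F \<noteq> {}" for F
  proof (cases "Suc s \<in> F")
    case False
    then have "F \<subseteq> {1..s}" using F by (auto simp: le_Suc_eq)
    then show ?thesis using old nz F by simp
  next
    case True
    define G where "G = F - {Suc s}"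
    have G: "G \<subseteq> {1..s}" "F = insert (Suc s) G" "Suc s \<notin> G" "finite G"
      using F True finite_subset[of F "{1..Suc s}"] by (auto simp: G_def le_Suc_eq)
    have yG: "finsum R y G \<in> carrier R" using G y by (intro finsum_closed) auto
    have "finsum R ?z F = a \<oplus> finsum R y G"
      unfolding G(2) using G a y old[OF G(1)] by (subst finsum_insert) auto
    moreover have "a \<oplus> finsum R y G \<noteq> \<zero>"
    proof
      assume "a \<oplus> finsum R y G = \<zero>"
      then have "a = \<ominus> finsum R y G" using yG a(1) by (simp add: minus_equality)
      then show False using a(2) G(1) by blast
    qed
    ultimately show ?thesis by simp
  qed
  then show ?case using z by blast
qed

section \<open>Construction of \<open>D\<close> from the dilates of \<open>A\<close>\<close>

theorem theorem4p4:
  fixes R :: "('a, 'm) ring_scheme" and s :: nat and A B :: "'a set"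
  assumes "s \<ge> 1"
    and "large_domain R"
    and "infinite (carrier R)"
    and "IP_star R A"
    and "IP_fin_star s R B"
  shows "\<exists>D. IP_star R D \<and> (\<forall>r\<in>D. PIdl\<^bsub>R\<^esub> r - {\<zero>\<^bsub>R\<^esub>} \<subseteq> A <#>\<^bsub>R\<^esub> B)"
proof -
  interpret domain R using assms(2) by (simp add: large_domain_def)
  obtain y where y: "y \<in> {1..s} \<rightarrow> carrier R"
    and nz: "\<forall>F. F \<subseteq> {1..s} \<and> F \<noteq> {} \<longrightarrow> finsum R y F \<noteq> \<zero>\<^bsub>R\<^esub>"
    using exists_nonzero_subset_sums[OF assms(3)] by (rule bexE)
  have yF: "finsum R y F \<in> carrier R" if "F \<subseteq> {1..s}" for F
    using that y by (intro finsum_closed) auto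
  define \<F> where "\<F> = {F. F \<subseteq> {1..s} \<and> F \<noteq> {}}"
  define D where "D = carrier R \<inter> (\<Inter>F\<in>\<F>. (\<lambda>a. a \<otimes>\<^bsub>R\<^esub> finsum R y F) ` A)"
  have "IP_star R ((\<lambda>a. a \<otimes>\<^bsub>R\<^esub> finsum R y F) ` A)" if "F \<in> \<F>" for F
  proof -
    have c: "finsum R y F \<in> carrier R" and n: "finsum R y F \<noteq> \<zero>\<^bsub>R\<^esub>"
      using that yF nz by (auto simp: \<F>_def)
    \<comment> \<open>The nonzero subset sums matter here: they generate nonzero ideals, which have
      finite index in a large domain.\<close>
    have "PIdl\<^bsub>R\<^esub> (finsum R y F) \<noteq> {\<zero>\<^bsub>R\<^esub>}" using cgenideal_self[OF c] n by blast
    then have "finite (a_rcosets\<^bsub>R\<^esub> (PIdl\<^bsub>R\<^esub> (finsum R y F)))"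
      using assms(2) cgenideal_ideal[OF c] by (simp add: large_domain_def)
    then show ?thesis using IP_star_dilate[OF assms(4) c n] by blast
  qed
  then have "IP_star R D"
    unfolding D_def by (intro IP_star_INT) (auto simp: \<F>_def)
  moreover have "m \<otimes>\<^bsub>R\<^esub> r \<in> A <#>\<^bsub>R\<^esub> B" if r: "r \<in> D" and m: "m \<in> carrier R" for r m
  proof -
    \<comment> \<open>The set \<open>F\<close> for which the scaled sum falls into \<open>B\<close>
      depends on \<open>m\<close>; this is why \<open>D\<close> lies in every dilate.\<close>
    let ?z = "\<lambda>i. m \<otimes>\<^bsub>R\<^esub> y i"
    let ?C = "{finsum R ?z F | F. F \<subseteq> {1..s} \<and> F \<noteq> {}}"
    have z: "?z \<in> {1..s} \<rightarrow> carrier R" using y m by auto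
    then have "?C \<subseteq> carrier R" by (auto intro!: finsum_closed)
    then have "IP_fin_set s R ?C" using z unfolding IP_fin_set_def by blast
    then have "B \<inter> ?C \<noteq> {}" using assms(5) unfolding IP_fin_star_def by blast
    then obtain F where F: "F \<subseteq> {1..s}" "F \<noteq> {}" "finsum R ?z F \<in> B" by blast
    have mF: "m \<otimes>\<^bsub>R\<^esub> finsum R y F = finsum R ?z F"
      using F y m finite_subset[OF F(1)] by (intro finsum_rdistr) auto
    have "F \<in> \<F>" using F by (simp add: \<F>_def)
    then obtain a where a: "a \<in> A" "r = a \<otimes>\<^bsub>R\<^esub> finsum R y F" using r unfolding D_def by blast
    have "a \<in> carrier R" using a(1) IP_star_subset[OF assms(4)] by blast
    \<comment> \<open>Commutativity moves \<open>m\<close> past \<open>a\<close> onto the subset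
      sum, which turns the second factor into the element found in \<open>B\<close>.\<close>
    then have "m \<otimes>\<^bsub>R\<^esub> r = a \<otimes>\<^bsub>R\<^esub> finsum R ?z F"
      unfolding a(2) mF[symmetric] using m yF[OF F(1)] by (simp add: m_lcomm)
    then show ?thesis using a(1) F(3) unfolding set_mult_def by blast
  qed
  ultimately show ?thesis unfolding cgenideal_def by blast
qed

end
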